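(* Fix a positive integer $d$. Then, with at most finitely many exceptional values of $m$, the following holds: whenever $m\equiv 5$ or $7 \pmod 8$, $S\subseteq D_{2m}\setminus\{e\}$ with $|S|=2m-2$, and the non-identity element $x$ of $D_{2m}$ not in $S$ has order $m/d$, the group $D_{2m}$ has an $S$-sequencing.
   Context: $D_{2m}=\langle u,v : u^m=e=v^2,\ vu=u^{m-1}v\rangle$ is the dihedral group of order $2m$. For $S\subseteq G\setminus\{e\}$ with $|S|=k$, an $S$-sequencing of $G$ is an ordering $(g_1,\dots,g_k)$ of the elements of $S$ such that the partial products $h_0=e$, $h_i=g_1\cdots g_i$ ($1\le i\le k$) are pairwise distinct. *)

theory Defs
  imports "HOL-Algebra.Multiplicative_Group"
begin

text \<open>The dihedral group D_{2m}: the element (i, b) with i < m stands for u^i v^b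
  (b = True meaning one factor v). Using v u^j = u^{-j} v we get
  u^i v^a u^j v^b = u^(i + (-1)^a j) v^(a+b).\<close>

definition dihedral_mult :: "nat \<Rightarrow> nat \<times> bool \<Rightarrow> nat \<times> bool \<Rightarrow> nat \<times> bool" where
  "dihedral_mult m g h =
     ((if snd g then fst g + (m - fst h) else fst g + fst h) mod m, snd g \<noteq> snd h)"

definition dihedral :: "nat \<Rightarrow> (nat \<times> bool) monoid" where
  "dihedral m = \<lparr> carrier = {..<m} \<times> UNIV, mult = dihedral_mult m, one = (0, False) \<rparr>"

definition is_S_sequencing :: "('a, 'b) monoid_scheme \<Rightarrow> 'a set \<Rightarrow> 'a list \<Rightarrow> bool" where
  "is_S_sequencing G S gs \<longleftrightarrow>
     distinct gs \<and> set gs = S \<and>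
     distinct (map (\<lambda>i. foldl (mult G) (one G) (take i gs)) [0..<Suc (length gs)])"

definition has_S_sequencing :: "('a, 'b) monoid_scheme \<Rightarrow> 'a set \<Rightarrow> bool" where
  "has_S_sequencing G S \<longleftrightarrow> (\<exists>gs. is_S_sequencing G S gs)"

end

theory Submission
  imports Defs "HOL-Number_Theory.Cong"
begin

text \<open>
  Write m = 2k + 1. Since m is odd, the omitted element has odd order, so it is a rotation
  u^a with gcd(a, m) = d. An S-sequencing amounts to a path through all but one of the elements of the
  group whose successive quotients are distinct and avoid u^a. In the coordinates (x, c) for the
  element v^c u^x, the quotient of two consecutive elements on the same side (equal c) is the
  difference of their x, and on opposite sides it is the sum. Multiplying all coordinates by a unit
  modulo m replaces u^a by u^D, where D is d or 2d, whichever has the parity of k + 1.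

  The zigzag 0, k, 1, k - 1, ... on the side c = True has steps k, -(k - 1), k - 2, ..., one for
  each absolute value. On the other side its reversal, with the step D left out, is traversed in
  two pieces, which supplies the remaining differences apart from D. The two pieces are joined by an
  alternating path whose cross sums form an interval. Its prescribed ends lie at a distance D + 1
  from the ends of an interval, and alternating paths with such ends are concatenations of blocks of two
  coprime lengths, so they exist on all long intervals.
\<close>

section \<open>Quotients along a path\<close>

type_synonym vertex = "int \<times> bool"

text \<open>This is g^-1 h lifted to integer coordinates. Reduction modulo m is postponed to
  \<open>elem\<close>, so the quotients along a path can be described by integer intervals.\<close>

definition quot :: "vertex \<Rightarrow> vertex \<Rightarrow> vertex" where
  "quot g h = (if snd g = snd h then fst h - fst g else fst g + fst h, snd g \<noteq> snd h)"

fun quots :: "vertex list \<Rightarrow> vertex list" where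
  "quots (g # h # hs) = quot g h # quots (h # hs)"
| "quots _ = []"

lemma length_quots [simp]: "length (quots hs) = length hs - 1"
  by (induction hs rule: quots.induct) auto

lemma quots_nth: "Suc i < length hs \<Longrightarrow> quots hs ! i = quot (hs ! i) (hs ! Suc i)"
proof (induction hs arbitrary: i rule: quots.induct)
  case (1 g h hs)
  then show ?case by (cases i) auto
qed auto

lemma quots_append:
  assumes "xs \<noteq> []" "ys \<noteq> []"
  shows "quots (xs @ ys) = quots xs @ quot (last xs) (hd ys) # quots ys"
  using assms
proof (induction xs rule: quots.induct)
  case ("2_2" v)
  then show ?case by (cases ys) auto
qed auto

lemma set_quots_append:
  assumes "xs \<noteq> []" "ys \<noteq> []"
  shows "set (quots (xs @ ys)) = set (quots xs) \<union> {quot (last xs) (hd ys)} \<union> set (quots ys)"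
  by (simp add: quots_append assms)

lemma set_quots_Cons:
  "hs \<noteq> [] \<Longrightarrow> set (quots (h # hs)) = insert (quot h (hd hs)) (set (quots hs))"
  by (cases hs) auto

section \<open>Alternating paths with consecutive sums\<close>

primrec ladder :: "bool \<Rightarrow> nat \<Rightarrow> int \<Rightarrow> int \<Rightarrow> vertex list" where
  "ladder c 0 p r = []"
| "ladder c (Suc n) p r = (p, c) # (r, \<not> c) # ladder c n (p + 1) (r + 1)"

lemma length_ladder [simp]: "length (ladder c n p r) = 2 * n"
  by (induction n arbitrary: p r) auto

lemma ladder_eq_Nil [simp]: "ladder c n p r = [] \<longleftrightarrow> n = 0"
  by (cases n) auto

lemma hd_ladder [simp]: "0 < n \<Longrightarrow> hd (ladder c n p r) = (p, c)"
  by (cases n) auto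

lemma last_ladder [simp]: "0 < n \<Longrightarrow> last (ladder c n p r) = (r + int n - 1, \<not> c)"
proof (induction n arbitrary: p r)
  case (Suc n)
  show ?case
  proof (cases "n = 0")
    case False
    then show ?thesis using Suc.IH[of "p + 1" "r + 1"] by simp
  qed simp
qed simp

lemma set_ladder:
  "set (ladder c n p r) = {p..<p + int n} \<times> {c} \<union> {r..<r + int n} \<times> {\<not> c}"
proof (induction n arbitrary: p r)
  case (Suc n)
  have "{p..<p + int (Suc n)} = insert p {p + 1..<p + 1 + int n}" for p :: int by auto
  then show ?case by (simp only: ladder.simps list.set Suc.IH) auto
qed simp

text \<open>Passing from one step to the next replaces one summand by its successor, so the cross
  sums increase by exactly 1.\<close>

lemma set_quots_ladder:
  assumes "0 < n"
  shows "set (quots (ladder c n p r)) = {p + r..p + r + 2 * int n - 2} \<times> {True}"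
  using assms
proof (induction n arbitrary: p r)
  case (Suc n)
  show ?case
  proof (cases n)
    case 0
    have "{p + r..p + r} = {p + r}" by auto
    then show ?thesis using 0 by (auto simp: quot_def)
  next
    case (Suc n')
    have "quots (ladder c (Suc n) p r) = (p + r, True) # (p + r + 1, True) # quots (ladder c n (p + 1) (r + 1))"
      using Suc by (simp add: quot_def)
    moreover have "{p + r..p + r + 2 * int (Suc n) - 2}
      = insert (p + r) (insert (p + r + 1) {p + 1 + (r + 1)..p + 1 + (r + 1) + 2 * int n - 2})"
      using Suc by auto
    moreover have "set (quots (ladder c n (p + 1) (r + 1)))
      = {p + 1 + (r + 1)..p + 1 + (r + 1) + 2 * int n - 2} \<times> {True}"
      using Suc Suc.IH by blast
    ultimately show ?thesis by (simp only: list.set) auto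
  qed
qed simp

text \<open>The last vertex is forced by the first: the sums determine the sum of the two end coordinates.\<close>

definition crossing_path :: "nat \<Rightarrow> nat \<Rightarrow> int \<Rightarrow> int \<Rightarrow> vertex list \<Rightarrow> bool" where
  "crossing_path s n p r hs \<longleftrightarrow>
     hs \<noteq> [] \<and> hd hs = (p + int s, False) \<and> last hs = (r + int n - 1 - int s, True) \<and>
     length hs = 2 * n \<and>
     set hs = {p..<p + int n} \<times> {False} \<union> {r..<r + int n} \<times> {True} \<and>
     set (quots hs) = {p + r..p + r + 2 * int n - 2} \<times> {True}"

text \<open>The upper halves of both intervals come first, then the lower halves. The two ladders
  miss only the middle sum p + r + 2s - 1, and the junction from (r + 2s - 1, True) to (p, False)
  supplies it.\<close>

lemma crossing_path_even:
  assumes "0 < s"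
  shows "crossing_path s (2 * s) p r (ladder False s (p + int s) (r + int s) @ ladder False s p r)"
proof -
  have 1: "{p + r..p + r + 2 * int (2 * s) - 2} = {p + int s + (r + int s)..p + int s + (r + int s) + 2 * int s - 2}
     \<union> {p + r + 2 * int s - 1} \<union> {p + r..p + r + 2 * int s - 2}"
    using assms by auto
  have 2: "{q..<q + int (2 * s)} = {q + int s..<q + int s + int s} \<union> {q..<q + int s}" for q :: int
    by auto
  show ?thesis
    unfolding crossing_path_def 1 2
    using assms by (auto simp: set_quots_append set_quots_ladder set_ladder quot_def)
qed

text \<open>As in the even case, but the middle vertices of the two intervals serve as ends. The
  three junctions then fill the gap p + r + 2s - 1, ..., p + r + 2s + 1 between the sums of the
  ladders.\<close>

lemma crossing_path_odd:
  assumes "0 < s"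
  shows "crossing_path s (2 * s + 1) p r
    ([(p + int s, False)] @ ladder True s (r + int s + 1) (p + int s + 1) @ ladder True s r p @
     [(r + int s, True)])"
proof -
  have 1: "{p + r..p + r + 2 * int (2 * s + 1) - 2} =
     {p + r + 2 * int s + 1}
     \<union> {r + int s + 1 + (p + int s + 1)..r + int s + 1 + (p + int s + 1) + 2 * int s - 2}
     \<union> {p + r + 2 * int s} \<union> {r + p..r + p + 2 * int s - 2} \<union> {p + r + 2 * int s - 1}"
    using assms by auto
  have 2: "{q..<q + int (2 * s + 1)} = {q + int s} \<union> {q + int s + 1..<q + int s + 1 + int s} \<union> {q..<q + int s}" for q :: int
    by auto
  show ?thesis
    unfolding crossing_path_def 1 2
    using assms
    by (auto simp: set_quots_append set_quots_Cons set_quots_ladder set_ladder quot_def)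
qed

text \<open>The end lies as far below the top of its interval as the start lies above the bottom. So
  s cancels in the junction sum, which is p + r + 2n - 1, the one value between the two ranges of
  sums.\<close>

lemma crossing_path_append:
  assumes "crossing_path s n p r xs" "crossing_path s n' (p + int n) (r + int n) ys"
  shows "crossing_path s (n + n') p r (xs @ ys)"
proof -
  have pos: "0 < n" "0 < n'" using assms by (auto simp: crossing_path_def)
  have 1: "{p + r..p + r + 2 * int (n + n') - 2} = {p + r..p + r + 2 * int n - 2} \<union> {p + r + 2 * int n - 1}
     \<union> {p + int n + (r + int n)..p + int n + (r + int n) + 2 * int n' - 2}"
    using pos by auto
  have 2: "{q..<q + int (n + n')} = {q..<q + int n} \<union> {q + int n..<q + int n + int n'}" for q :: int
    by auto
  show ?thesis
    unfolding crossing_path_def 1 2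
    using assms by (auto simp: crossing_path_def set_quots_append quot_def)
qed

lemma crossing_path_exists_combination:
  assumes "0 < s" "0 < a + b"
  shows "\<exists>hs. crossing_path s (a * (2 * s) + b * (2 * s + 1)) p r hs"
  using assms(2)
proof (induction "a + b" arbitrary: a b p r)
  case (Suc n)
  let ?N = "\<lambda>a b. a * (2 * s) + b * (2 * s + 1)"
  obtain l xs a' b' where *: "crossing_path s l p r xs" "a' + b' = n" "?N a b = l + ?N a' b'"
  proof (cases a)
    case 0
    then obtain b' where "b = Suc b'" using Suc.prems by (cases b) auto
    then show ?thesis
      using that[OF crossing_path_odd[OF assms(1)], of 0 b'] Suc.hyps(2) 0 by simp
  next
    case (Suc a')
    then show ?thesis
      using that[OF crossing_path_even[OF assms(1)], of a' b] Suc.hyps(2) by simp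
  qed
  show ?case
  proof (cases "n = 0")
    case True
    then show ?thesis using * by auto
  next
    case False
    then obtain ys where "crossing_path s (?N a' b') (p + int l) (r + int l) ys"
      using Suc.hyps(1)[of a' b'] *(2) by auto
    then show ?thesis using crossing_path_append[OF *(1)] *(3) by auto
  qed
qed simp

text \<open>Divide n by 2s: the bound makes the quotient q at least 2s, hence larger than the
  remainder t. So t of the q blocks of length 2s can be lengthened by 1.\<close>

lemma crossing_path_exists:
  assumes "0 < s" "4 * s ^ 2 \<le> n"
  shows "\<exists>hs. crossing_path s n p r hs"
proof -
  define q t where "q = n div (2 * s)" and "t = n mod (2 * s)"
  have n: "n = q * (2 * s) + t" by (simp only: q_def t_def div_mult_mod_eq)
  have "2 * s * (2 * s) \<le> n" using assms(2) by (simp add: power2_eq_square)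
  then have "2 * s \<le> q" using assms(1) by (simp add: q_def less_eq_div_iff_mult_less_eq)
  moreover have "t < 2 * s" using assms(1) by (simp add: t_def)
  ultimately have t: "t \<le> q" "0 < q" by auto
  then obtain a where a: "q = a + t" by (metis le_add_diff_inverse2)
  have "n = a * (2 * s) + t * (2 * s + 1)" unfolding n a by (simp add: algebra_simps)
  then show ?thesis using crossing_path_exists_combination[OF assms(1), of a t p r] t a by auto
qed

section \<open>Zigzags\<close>

primrec zigzag :: "int \<Rightarrow> int \<Rightarrow> nat \<Rightarrow> int list" where
  "zigzag e x 0 = [x]"
| "zigzag e x (Suc n) = x # zigzag (- e) (x + e * int (Suc n)) n"

lemma zigzag_neq_Nil [simp]: "zigzag e x n \<noteq> []"
  by (cases n) auto

lemma hd_zigzag [simp]: "hd (zigzag e x n) = x"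
  by (cases n) auto

lemma length_zigzag [simp]: "length (zigzag e x n) = Suc n"
  by (induction n arbitrary: e x) auto

text \<open>After its first step a zigzag continues as one of opposite sign from the far end of the
  interval, so both signs share one induction.\<close>

lemma set_zigzag: "set (zigzag 1 x n) = {x..x + int n}" "set (zigzag (-1) x n) = {x - int n..x}"
proof (induction n arbitrary: x)
  case (Suc n)
  { case 1 show ?case by (auto simp: Suc.IH) next
    case 2 show ?case by (auto simp: Suc.IH) }
qed auto

definition on_side :: "bool \<Rightarrow> int list \<Rightarrow> vertex list" where
  "on_side c xs = map (\<lambda>x. (x, c)) xs"

lemma on_side_simps [simp]:
  "on_side c [] = []" "on_side c (x # xs) = (x, c) # on_side c xs"
  "length (on_side c xs) = length xs" "on_side c xs = [] \<longleftrightarrow> xs = []"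
  "set (on_side c xs) = set xs \<times> {c}"
  by (auto simp: on_side_def)

lemma hd_on_side [simp]: "xs \<noteq> [] \<Longrightarrow> hd (on_side c xs) = (hd xs, c)"
  and last_on_side [simp]: "xs \<noteq> [] \<Longrightarrow> last (on_side c xs) = (last xs, c)"
  by (simp_all add: on_side_def hd_map last_map)

text \<open>Signs alternate from e at the longest step n, so the step of length j has sign e exactly
  when n - j is even.\<close>

lemma set_quots_zigzag:
  "set (quots (on_side c (zigzag e x n))) =
    (\<lambda>j. (e * (if even (n - j) then int j else - int j), False)) ` {1..n}"
proof (induction n arbitrary: e x)
  case (Suc n)
  have "set (quots (on_side c (zigzag e x (Suc n)))) =
     insert (e * int (Suc n), False) ((\<lambda>j. (- e * (if even (n - j) then int j else - int j), False)) ` {1..n})"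
    by (simp add: set_quots_Cons quot_def Suc.IH)
  also have "(\<lambda>j. (- e * (if even (n - j) then int j else - int j), False)) ` {1..n} =
     (\<lambda>j. (e * (if even (Suc n - j) then int j else - int j), False)) ` {1..n}"
    by (rule image_cong) (auto simp: Suc_diff_le)
  finally show ?case by (simp add: atLeastAtMostSuc_conv)
qed auto

text \<open>Through this sign change a reversed zigzag supplies the differences that the other one
  lacks.\<close>

lemma set_quots_on_side_rev:
  "set (quots (on_side c (rev xs))) = (\<lambda>(y, b). (- y, b)) ` set (quots (on_side c xs))"
proof (induction xs)
  case (Cons x xs)
  show ?case
  proof (cases "xs = []")
    case False
    have "on_side c (rev (x # xs)) = on_side c (rev xs) @ [(x, c)]" by (simp add: on_side_def)
    then show ?thesis using False Cons
      by (simp add: set_quots_append set_quots_Cons quot_def last_rev)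
  qed simp
qed simp

text \<open>The reversal of the first 2n entries of zigzag 1 0 k.\<close>

primrec shell :: "int \<Rightarrow> nat \<Rightarrow> int list" where
  "shell k 0 = []"
| "shell k (Suc i) = (k - int i) # int i # shell k i"

lemma shell_eq_Nil [simp]: "shell k n = [] \<longleftrightarrow> n = 0"
  by (cases n) auto

lemma hd_shell [simp]: "0 < n \<Longrightarrow> hd (shell k n) = k - int n + 1"
  by (cases n) auto

lemma last_shell [simp]: "0 < n \<Longrightarrow> last (shell k n) = 0"
  by (induction n) auto

lemma length_shell [simp]: "length (shell k n) = 2 * n"
  by (induction n) auto

lemma set_shell: "set (shell k n) = {0..<int n} \<union> {k - int n + 1..k}"
proof (induction n)
  case (Suc n)
  show ?case by (auto simp: Suc)
qed auto

text \<open>The first family consists of the steps from k - i to i, the second of those from i to k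
  - (i - 1).\<close>

lemma set_quots_shell:
  "i < n \<Longrightarrow> (2 * int i - k, False) \<in> set (quots (on_side c (shell k n)))"
  "1 \<le> i \<Longrightarrow> i < n \<Longrightarrow> (k - 2 * int i + 1, False) \<in> set (quots (on_side c (shell k n)))"
proof (induction n)
  case (Suc n)
  have *: "set (quots (on_side c (shell k (Suc n)))) = insert (2 * int n - k, False)
      (insert (k - 2 * int n + 1, False) (set (quots (on_side c (shell k n)))))" if "n \<noteq> 0"
    using that by (simp add: set_quots_Cons quot_def algebra_simps)
  { case 1
    then show ?case using Suc.IH(1) * by (cases "n = 0") (auto simp: quot_def less_Suc_eq)
  next
    case 2
    then show ?case using Suc.IH(2) * by (cases "n = 0") (auto simp: less_Suc_eq) }
qed simp_all

section \<open>The dihedral group\<close>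

lemma dihedral_carrier [simp]: "carrier (dihedral m) = {..<m} \<times> UNIV"
  and dihedral_one [simp]: "\<one>\<^bsub>dihedral m\<^esub> = (0, False)"
  and dihedral_mult_eq [simp]: "monoid.mult (dihedral m) = dihedral_mult m"
  by (simp_all add: dihedral_def)

text \<open>Here (x, c) encodes v^c u^x, which is u^(-x) v if c holds, whereas a group element (i, c) is u^i v^c.\<close>

definition elem :: "nat \<Rightarrow> vertex \<Rightarrow> nat \<times> bool" where
  "elem m g = (nat ((if snd g then - fst g else fst g) mod int m), snd g)"

lemma elem_in_carrier [simp]: "0 < m \<Longrightarrow> elem m g \<in> carrier (dihedral m)"
  by (auto simp: elem_def nat_less_iff)

lemma elem_eq_iff:
  assumes "0 < m"
  shows "elem m g = elem m h \<longleftrightarrow> snd g = snd h \<and> int m dvd fst g - fst h"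
proof -
  have "elem m g = elem m h \<longleftrightarrow> snd g = snd h \<and>
    (if snd g then - fst g else fst g) mod int m = (if snd g then - fst h else fst h) mod int m"
    using assms by (auto simp: elem_def eq_nat_nat_iff)
  also have "\<dots> \<longleftrightarrow> snd g = snd h \<and> int m dvd fst g - fst h"
    by (auto simp: mod_eq_dvd_iff dvd_diff_commute)
  finally show ?thesis .
qed

lemma elem_surj:
  assumes "y \<in> carrier (dihedral m)"
  obtains z where "y = elem m (z, snd y)"
proof
  show "y = elem m (if snd y then - int (fst y) else int (fst y), snd y)"
    using assms by (auto simp: elem_def prod_eq_iff)
qed

text \<open>Moving u^x to the right past a factor v inverts it: u^x v = v u^(-x).\<close>

lemma dihedral_mult_elem:
  assumes "0 < m"
  shows "dihedral_mult m (elem m (x, b)) (elem m (y, c)) = elem m (if c then y - x else x + y, b \<noteq> c)"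
proof -
  define p where "p = (if b then - x else x) mod int m"
  define q where "q = (if c then - y else y) mod int m"
  have bounds: "0 \<le> p" "p < int m" "0 \<le> q" "q < int m" using assms by (auto simp: p_def q_def)
  \<comment> \<open>As q < m, the natural subtraction m - q is not truncated, so the computation can
    move to the integers.\<close>
  have "int (if b then nat p + (m - nat q) else nat p + nat q) = (if b then p - q + int m else p + q)"
    using bounds by (auto simp: of_nat_diff)
  then have "int ((if b then nat p + (m - nat q) else nat p + nat q) mod m) = (if b then p - q else p + q) mod int m"
    by (simp add: of_nat_mod)
  also have "\<dots> = (if b then (if b then - x else x) - (if c then - y else y)
     else (if b then - x else x) + (if c then - y else y)) mod int m"
    by (simp add: p_def q_def mod_simps)
  also have "\<dots> = (if b \<noteq> c then - (if c then y - x else x + y) else (if c then y - x else x + y)) mod int m"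
    by (auto simp: algebra_simps)
  finally have "(if b then nat p + (m - nat q) else nat p + nat q) mod m =
      nat ((if b \<noteq> c then - (if c then y - x else x + y) else (if c then y - x else x + y)) mod int m)"
    by (metis nat_int)
  then show ?thesis
    by (simp only: dihedral_mult_def elem_def fst_conv snd_conv flip: p_def q_def)
qed

lemma group_dihedral:
  assumes "0 < m"
  shows "group (dihedral m)"
proof (rule groupI)
  fix x y z assume x: "x \<in> carrier (dihedral m)" and y: "y \<in> carrier (dihedral m)"
    and z: "z \<in> carrier (dihedral m)"
  obtain a b c where eqs: "x = elem m (a, snd x)" "y = elem m (b, snd y)" "z = elem m (c, snd z)"
    using x y z elem_surj by metis
  show "x \<otimes>\<^bsub>dihedral m\<^esub> y \<in> carrier (dihedral m)"
    using assms by (subst eqs(1), subst eqs(2)) (simp add: dihedral_mult_elem del: dihedral_carrier)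
  show "x \<otimes>\<^bsub>dihedral m\<^esub> y \<otimes>\<^bsub>dihedral m\<^esub> z = x \<otimes>\<^bsub>dihedral m\<^esub> (y \<otimes>\<^bsub>dihedral m\<^esub> z)"
    by (subst (1 2) eqs(1), subst (1 2) eqs(2), subst (1 2) eqs(3))
       (auto simp: dihedral_mult_elem assms elem_eq_iff)
next
  have one: "\<one>\<^bsub>dihedral m\<^esub> = elem m (0, False)" by (simp add: elem_def)
  show "\<one>\<^bsub>dihedral m\<^esub> \<in> carrier (dihedral m)" using assms by simp
  fix x assume x: "x \<in> carrier (dihedral m)"
  then obtain a where a: "x = elem m (a, snd x)" using elem_surj by metis
  show "\<one>\<^bsub>dihedral m\<^esub> \<otimes>\<^bsub>dihedral m\<^esub> x = x"
    by (subst (1 2) a) (auto simp: one dihedral_mult_elem assms elem_eq_iff simp del: dihedral_one)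
  let ?y = "elem m (if snd x then a else - a, snd x)"
  have "?y \<otimes>\<^bsub>dihedral m\<^esub> x = \<one>\<^bsub>dihedral m\<^esub>"
    by (subst (2) a) (auto simp: one dihedral_mult_elem assms elem_eq_iff simp del: dihedral_one)
  then show "\<exists>y\<in>carrier (dihedral m). y \<otimes>\<^bsub>dihedral m\<^esub> x = \<one>\<^bsub>dihedral m\<^esub>"
    using elem_in_carrier[OF assms] by blast
qed

lemma elem_inv_mult:
  assumes "0 < m"
  shows "inv\<^bsub>dihedral m\<^esub> elem m g \<otimes>\<^bsub>dihedral m\<^esub> elem m h = elem m (quot g h)"
proof -
  interpret group "dihedral m" by (rule group_dihedral[OF assms])
  have "elem m g \<otimes>\<^bsub>dihedral m\<^esub> elem m (quot g h) = elem m h"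
    by (cases g; cases h) (auto simp: quot_def dihedral_mult_elem assms elem_eq_iff)
  then show ?thesis
    using inv_solve_left'[of "elem m (quot g h)" "elem m g" "elem m h"] elem_in_carrier[OF assms] by simp
qed

text \<open>The product of the first i quotients telescopes to h_0^-1 h_i, and left multiplication
  by h_0^-1 is injective.\<close>

lemma (in group) is_S_sequencing_quotients:
  assumes "set (h # hs) \<subseteq> carrier G" "distinct (h # hs)"
    and "gs = map2 (\<lambda>x y. inv x \<otimes> y) (h # hs) hs" "distinct gs"
  shows "is_S_sequencing G (set gs) gs"
proof -
  have len: "length gs = length hs" using assms(3) by simp
  have carr: "(h # hs) ! i \<in> carrier G" if "i < length (h # hs)" for i
    using assms(1) nth_mem[OF that] by blast
  have prod: "foldl (\<otimes>) \<one> (take i gs) = inv h \<otimes> (h # hs) ! i" if "i \<le> length hs" for i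
    using that
  proof (induction i)
    case 0
    then show ?case using assms(1) by simp
  next
    case (Suc i)
    have "foldl (\<otimes>) \<one> (take (Suc i) gs) = foldl (\<otimes>) \<one> (take i gs) \<otimes> gs ! i"
      using Suc.prems len by (simp add: take_Suc_conv_app_nth)
    also have "\<dots> = inv h \<otimes> (h # hs) ! i \<otimes> (inv ((h # hs) ! i) \<otimes> hs ! i)"
      using Suc assms(3) by simp
    also have "\<dots> = inv h \<otimes> hs ! i"
      using carr[of i] carr[of "Suc i"] assms(1) Suc.prems
      by (simp add: m_assoc flip: m_assoc[of "(h # hs) ! i"])
    finally show ?case by simp
  qed
  have "map (\<lambda>i. foldl (\<otimes>) \<one> (take i gs)) [0..<Suc (length gs)] =
    map (\<lambda>x. inv h \<otimes> x) (h # hs)"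
    by (rule nth_equalityI) (simp_all add: len prod del: upt_Suc list.map)
  moreover have "inj_on (\<lambda>x. inv h \<otimes> x) (set (h # hs))"
    using assms(1) by (intro inj_on_subset[OF inj_on_cmult]) auto
  ultimately show ?thesis
    using assms(2,4) by (simp only: is_S_sequencing_def distinct_map)
qed

section \<open>The path\<close>

lemma set_quots_ladder_Cons:
  assumes "0 < n"
  shows "set (quots ((q, True) # ladder False n p r)) = insert (q + p, True) ({p + r..p + r + 2 * int n - 2} \<times> {True})"
  using assms by (simp add: set_quots_Cons set_quots_ladder quot_def)

text \<open>Modulo 2k + 1, the cross sums listed represent every residue once, and the differences
  every residue except 0 and D. Inclusions are enough here: with the exact length, a later count
  excludes repetitions.\<close>

lemma near_hamiltonian_path:
  assumes "k + 1 = 2 * c + D" "3 \<le> c" "0 < D" "4 * (D + 1) ^ 2 \<le> c + D"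
  obtains hs where "length hs = 4 * k + 1"
    and "({0..2 * int k} \<times> UNIV) - {(int k + 1, False)} \<subseteq> set hs"
    and "({- int k..int k} - {0, int D}) \<times> {False} \<union>
         ({0} \<union> {2 * int k} \<union> {2 * int k + 2..4 * int k}) \<times> {True} \<subseteq> set (quots hs)"
proof -
  let ?k = "int k" and ?c = "int c" and ?D = "int D"
  have k: "?k + 1 = 2 * ?c + ?D" using assms(1) by linarith
  have c2: "int (c - 2) = ?c - 2" using assms(2) by simp
  \<comment> \<open>The offset D + 1 puts the start at k + D + 3. Joined to the last vertex (2k,
    True) of \<open>asc\<close>, it gives 3k + D + 3, the one sum between the ranges of
    \<open>zs\<close> and \<open>asc\<close>.\<close>
  obtain zs where zs: "crossing_path (D + 1) (c + D) (?k + 2) (?k + 1) zs"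
    using crossing_path_exists[of "D + 1" "c + D"] assms(4) by auto
  \<comment> \<open>\<open>inner\<close> followed by \<open>outer\<close> would be the reversed
    zigzag on 0, ..., k. Its step from c to k - c + 1 = c + D has the forbidden difference D, and
    the detour through \<open>asc\<close> and \<open>zs\<close> replaces it.\<close>
  define inner where "inner = on_side False (rev (zigzag 1 ?c (D - 1)))"
  \<comment> \<open>Since (k + 1, False) is left out, the side True has one vertex more beyond k. It
    is placed in front of the ladder, where it meets (c, False) with sum 2k + 2.\<close>
  define asc where "asc = (?k + 1 + ?c + ?D, True) # ladder False (c - 2) (?k + 2 + ?c + ?D) (?k + 2 + ?c + ?D)"
  define outer where "outer = on_side False (shell ?k c)"
  define whole where "whole = on_side True (zigzag 1 0 k)"
  note defs = inner_def asc_def outer_def whole_def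
  have ne: "inner \<noteq> []" "asc \<noteq> []" "zs \<noteq> []" "outer \<noteq> []" "whole \<noteq> []"
    using zs assms(2) by (auto simp: defs crossing_path_def)
  have hds: "hd asc = (?k + 1 + ?c + ?D, True)" "hd zs = (?k + ?D + 3, False)"
     "hd outer = (?k - ?c + 1, False)" "hd whole = (0, True)"
    using zs assms(2) by (simp_all add: defs crossing_path_def)
  have lasts: "last inner = (?c, False)" "last asc = (2 * ?k, True)"
     "last zs = (?k + ?c - 1, True)" "last outer = (0, False)"
    using zs assms k by (simp_all add: defs crossing_path_def last_rev of_nat_diff)
  let ?hs = "inner @ asc @ zs @ outer @ whole"
  have "length ?hs = 4 * k + 1"
    using zs assms by (simp add: defs crossing_path_def)
  moreover have "({0..2 * ?k} \<times> UNIV) - {(?k + 1, False)} \<subseteq> set ?hs"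
  proof -
    have A: "set inner = {?c..?c + ?D - 1} \<times> {False}" "set outer = ({0..<?c} \<union> {?k - ?c + 1..?k}) \<times> {False}"
      "set whole = {0..?k} \<times> {True}"
      using assms(3) by (simp_all add: defs set_zigzag set_shell of_nat_diff add_diff_eq)
    have B: "set zs = {?k + 2..<?k + 2 + ?c + ?D} \<times> {False} \<union> {?k + 1..<?k + 1 + ?c + ?D} \<times> {True}"
      using zs by (simp add: crossing_path_def algebra_simps)
    have C: "set asc = insert (?k + 1 + ?c + ?D, True)
       ({?k + 2 + ?c + ?D..2 * ?k} \<times> {False} \<union> {?k + 2 + ?c + ?D..2 * ?k} \<times> {True})"
    proof -
      have *: "?k + 2 + ?c + ?D + int (c - 2) = 2 * ?k + 1" using k c2 by linarith
      have **: "{z..<2 * ?k + 1} = {z..2 * ?k}" for z by auto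
      show ?thesis unfolding asc_def list.set set_ladder * ** by simp
    qed
    show ?thesis
    proof
      fix v :: vertex assume "v \<in> ({0..2 * ?k} \<times> UNIV) - {(?k + 1, False)}"
      then obtain x b where v: "v = (x, b)" "0 \<le> x" "x \<le> 2 * ?k" "b \<or> x \<noteq> ?k + 1"
        by (cases v) auto
      show "v \<in> set ?hs"
      proof (cases b)
        case True
        then show ?thesis using v unfolding set_append A B C by simp linarith
      next
        case False
        then show ?thesis using v k unfolding set_append A B C by simp linarith
      qed
    qed
  qed
  moreover have "({- ?k..?k} - {0, ?D}) \<times> {False} \<union>
         ({0} \<union> {2 * ?k} \<union> {2 * ?k + 2..4 * ?k}) \<times> {True} \<subseteq> set (quots ?hs)"
  proof -
    have Q: "set (quots ?hs) = set (quots inner) \<union> set (quots asc) \<union> set (quots zs) \<union> set (quots outer)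
       \<union> set (quots whole) \<union> {(2 * ?k + 2, True), (3 * ?k + ?D + 3, True), (2 * ?k, True), (0, True)}"
    proof -
      have "quot (last inner) (hd asc) = (2 * ?k + 2, True)" "quot (last asc) (hd zs) = (3 * ?k + ?D + 3, True)"
        "quot (last zs) (hd outer) = (2 * ?k, True)" "quot (last outer) (hd whole) = (0, True)"
        using k by (simp_all add: quot_def hds lasts)
      then show ?thesis by (simp add: set_quots_append ne Un_ac insert_commute)
    qed
    have qasc: "set (quots asc) = {2 * ?k + 2 * ?c + 2 * ?D + 3..4 * ?k} \<times> {True}"
    proof -
      let ?p = "?k + 2 + ?c + ?D"
      have p: "?p + ?p + 2 * int (c - 2) - 2 = 4 * ?k" using k c2 by linarith
      have "set (quots asc) = insert (?k + 1 + ?c + ?D + ?p, True) ({?p + ?p..4 * ?k} \<times> {True})"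
        using assms(2) by (subst p[symmetric], subst asc_def, subst set_quots_ladder_Cons) simp_all
      also have "\<dots> = insert (?k + 1 + ?c + ?D + ?p) {?p + ?p..4 * ?k} \<times> {True}" by simp
      also have "insert (?k + 1 + ?c + ?D + ?p) {?p + ?p..4 * ?k} = {2 * ?k + 2 * ?c + 2 * ?D + 3..4 * ?k}"
        using k assms(2) by auto
      finally show ?thesis .
    qed
    have qzs: "set (quots zs) = {2 * ?k + 3..2 * ?k + 2 * ?c + 2 * ?D + 1} \<times> {True}"
      using zs by (simp add: crossing_path_def algebra_simps)
    have outer: "i < c \<Longrightarrow> (2 * int i - ?k, False) \<in> set (quots outer)"
      "1 \<le> i \<Longrightarrow> i < c \<Longrightarrow> (?k - 2 * int i + 1, False) \<in> set (quots outer)" for i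
      using set_quots_shell[of i c ?k False] unfolding defs by auto
    have "({0} \<union> {2 * ?k} \<union> {2 * ?k + 2..4 * ?k}) \<times> {True} \<subseteq> set (quots ?hs)"
    proof -
      have eq: "{0} \<union> {2 * ?k} \<union> {2 * ?k + 2..4 * ?k} = {0, 2 * ?k, 2 * ?k + 2, 3 * ?k + ?D + 3} \<union>
          {2 * ?k + 3..2 * ?k + 2 * ?c + 2 * ?D + 1} \<union> {2 * ?k + 2 * ?c + 2 * ?D + 3..4 * ?k}"
        using k assms(2) by auto
      have "{0, 2 * ?k, 2 * ?k + 2, 3 * ?k + ?D + 3} \<times> {True} \<subseteq> set (quots ?hs)"
        unfolding Q by simp
      moreover have "set (quots zs) \<subseteq> set (quots ?hs)" "set (quots asc) \<subseteq> set (quots ?hs)"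
        unfolding Q by auto
      ultimately show ?thesis unfolding eq Sigma_Un_distrib1 qasc qzs by simp
    qed
    moreover have "(y, False) \<in> set (quots ?hs)" if y: "y \<in> {- ?k..?k}" "y \<noteq> 0" "y \<noteq> ?D" for y
    proof -
      define j where "j = nat \<bar>y\<bar>"
      have j: "1 \<le> j" "j \<le> k" using y by (auto simp: j_def)
      have yj: "y = int j \<or> y = - int j" by (auto simp: j_def)
      \<comment> \<open>For each absolute value j, \<open>whole\<close> supplies one sign. The other
        comes from \<open>inner\<close> if j < D and from \<open>outer\<close> if j > D.\<close>
      consider (whole) "y = (if even (k - j) then int j else - int j)"
        | (inner) "y = - (if even (k - j) then int j else - int j)" "j < D"
        | (up) "y = int j" "odd (k - j)" "D < j"
        | (down) "y = - int j" "even (k - j)" "D < j"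
        | (D) "y = - int j" "j = D" "even (k - j)"
        using yj y(3) by (cases "even (k - j)"; cases j D rule: linorder_cases) auto
      then show ?thesis
      proof cases
        case whole
        then have "(y, False) \<in> set (quots whole)"
          using j by (auto simp: defs set_quots_zigzag)
        then show ?thesis unfolding Q by blast
      next
        case inner
        have "even (k - j) \<longleftrightarrow> even (D - 1 - j)"
          using assms(1,3) inner(2) j by presburger
        then have "(- y, False) \<in> set (quots (on_side False (zigzag 1 ?c (D - 1))))"
          unfolding set_quots_zigzag using j(1) inner by (intro image_eqI[of _ _ j]) auto
        then have "(y, False) \<in> set (quots inner)"
          unfolding inner_def set_quots_on_side_rev by (rule rev_image_eqI) simp
        then show ?thesis unfolding Q by blast
      next
        case up
        obtain i where i: "1 \<le> i" "i < c" "k + 1 = j + 2 * i"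
        proof
          show "1 \<le> (k + 1 - j) div 2" "(k + 1 - j) div 2 < c" "k + 1 = j + 2 * ((k + 1 - j) div 2)"
            using up(2,3) j assms(1) by presburger+
        qed
        then have "?k - 2 * int i + 1 = y" using up(1) by linarith
        then have "(y, False) \<in> set (quots outer)"
          using outer(2)[of i] i by simp
        then show ?thesis unfolding Q by blast
      next
        case down
        obtain i where i: "i < c" "k = j + 2 * i"
        proof
          show "(k - j) div 2 < c" "k = j + 2 * ((k - j) div 2)"
            using down(2,3) j assms(1) by presburger+
        qed
        then have "2 * int i - ?k = y" using down(1) by linarith
        then have "(y, False) \<in> set (quots outer)"
          using outer(1)[of i] i by simp
        then show ?thesis unfolding Q by blast
      next
        case D
        \<comment> \<open>This case is empty: k + 1 = 2c + D makes k - D odd, so -D is already a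
          step of \<open>whole\<close>.\<close>
        then show ?thesis using assms(1,3) j by presburger
      qed
    qed
    ultimately show ?thesis by blast
  qed
  ultimately show ?thesis using that by blast
qed

section \<open>Normalising the omitted rotation\<close>

text \<open>Divided by their common gcd with m, both a and b become units modulo m', so a ratio v
  exists there. It remains to lift v to a unit modulo m.\<close>

lemma exists_unit_cong:
  fixes a b m :: nat
  assumes "0 < m" "gcd a m = gcd b m"
  obtains t where "coprime t m" "[t * a = b] (mod m)"
proof -
  define g where "g = gcd a m"
  have g: "g \<noteq> 0" "gcd a m = g" "gcd b m = g" using assms by (simp_all add: g_def)
  obtain a' m' where a: "a = a' * g" and m: "m = m' * g" and a': "coprime a' m'"
    using gcd_coprime_exists[of a m] g(1) unfolding g(2) by blast
  obtain b' m'' where b: "b = b' * g" and m'': "m = m'' * g" and b': "coprime b' m''"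
    using gcd_coprime_exists[of b m] g(1) unfolding g(3) by blast
  have "m'' = m'" using trans[OF m''[symmetric] m] g(1) by simp
  obtain u where u: "[a' * u = 1] (mod m')"
    using cong_solve_coprime_nat[OF a'] by auto
  define v where "v = u * b'"
  have "coprime u m'"
    unfolding coprime_iff_invertible_nat using u by (auto simp: mult.commute[of u] intro!: exI[of _ a'])
  then have v: "coprime v m'" using b' \<open>m'' = m'\<close> by (simp add: v_def)
  text \<open>Adding a multiple of m' keeps the residue modulo m' but makes t a unit modulo m.\<close>
  define P where "P = {p. prime p \<and> p dvd m \<and> \<not> p dvd v}"
  have "P \<subseteq> {p. p dvd m}" by (auto simp: P_def)
  then have fin: "finite P" using assms(1) finite_divisors_nat finite_subset by blast
  define t where "t = v + m' * \<Prod>P"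
  have "coprime t m"
  proof (rule ccontr)
    assume "\<not> coprime t m"
    then have "gcd t m \<noteq> 1" by (simp add: coprime_iff_gcd_eq_1)
    then obtain p where "prime p" "p dvd gcd t m" using prime_factor_nat by blast
    then have p: "prime p" "p dvd t" "p dvd m" by auto
    show False
    proof (cases "p dvd v")
      case True
      then have "p dvd m' * \<Prod>P" using p(2) by (simp add: t_def dvd_add_right_iff)
      moreover have "\<not> p dvd m'"
        using coprime_common_divisor[OF v True] p(1) by (auto simp: prime_nat_iff)
      ultimately have "p dvd \<Prod>P" using p(1) by (simp add: prime_dvd_mult_iff)
      then obtain q where "q \<in> P" "p dvd q"
        using prime_dvd_prod_iff[OF fin p(1), of "\<lambda>x. x"] by auto
      then show False using True p(1) primes_dvd_imp_eq[of p q] by (auto simp: P_def)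
    next
      case False
      then have "p dvd \<Prod>P" using p by (intro dvd_prod_eqI[OF fin, of p]) (simp_all add: P_def)
      then show False using False p(2) by (simp add: t_def dvd_add_left_iff)
    qed
  qed
  moreover have "[t * a = b] (mod m)"
  proof -
    have "[t = v] (mod m')" by (simp add: t_def cong_def)
    then have "[t * a' = v * a'] (mod m')" by (rule cong_scalar_right)
    also have "v * a' = a' * u * b'" by (simp add: v_def)
    also have "[a' * u * b' = 1 * b'] (mod m')" using u by (rule cong_scalar_right)
    finally have "[t * a' = b'] (mod m')" by simp
    then have "[t * a' * g = b' * g] (mod (m' * g))" by (rule cong_cmult_rightI)
    then show ?thesis by (simp add: a b m mult.assoc)
  qed
  ultimately show ?thesis using that by blast
qed

text \<open>A reflection squares to the identity, while the order of x is an odd number other than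
  1. So x is a rotation u^a, whose order is m / gcd(a, m).\<close>

lemma dihedral_ord:
  assumes "odd m" "x \<in> carrier (dihedral m)" "x \<noteq> \<one>\<^bsub>dihedral m\<^esub>"
    and ord: "group.ord (dihedral m) x * d = m"
  shows "x = (fst x, False)" "gcd (fst x) m = d"
proof -
  have "0 < m" using assms(1) by (rule odd_pos)
  interpret group "dihedral m" by (rule group_dihedral[OF \<open>0 < m\<close>])
  have one: "\<one>\<^bsub>dihedral m\<^esub> = elem m (0, False)" by (simp add: elem_def)
  obtain z where z: "x = elem m (z, snd x)" using elem_surj assms(2) by metis
  have "\<not> snd x"
  proof
    assume "snd x"
    then have "x = elem m (z, True)" using z by simp
    then have "x [^]\<^bsub>dihedral m\<^esub> (2::nat) = \<one>\<^bsub>dihedral m\<^esub>"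
      using assms(2) \<open>0 < m\<close>
      by (simp add: numeral_2_eq_2 dihedral_mult_elem one del: dihedral_one dihedral_carrier)
    then have "ord x dvd 2" using pow_eq_id[OF assms(2)] by blast
    moreover have "odd (ord x)" using ord assms(1) by (metis even_mult_iff)
    ultimately have "ord x = 1"
      using two_is_prime_nat by (auto simp: prime_nat_iff)
    then have "x [^]\<^bsub>dihedral m\<^esub> (1::nat) = \<one>\<^bsub>dihedral m\<^esub>"
      using pow_eq_id[OF assms(2), of 1] by simp
    then show False using assms(3) nat_pow_eone[OF assms(2)] by (simp only: simp_thms)
  qed
  then show x: "x = (fst x, False)" by (simp add: prod_eq_iff)
  define a where "a = fst x"
  have "a < m" using assms(2) by (auto simp: a_def)
  then have xa: "x = elem m (int a, False)" using x by (simp add: elem_def flip: a_def)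
  have pow: "x [^]\<^bsub>dihedral m\<^esub> n = elem m (int (n * a), False)" for n :: nat
  proof (induction n)
    case 0
    show ?case by (simp add: elem_def)
  next
    case (Suc n)
    then show ?case using \<open>0 < m\<close>
      by (simp add: dihedral_mult_elem xa algebra_simps del: dihedral_carrier)
  qed
  have dvd: "ord x dvd n \<longleftrightarrow> m dvd n * a" for n
  proof -
    have "ord x dvd n \<longleftrightarrow> elem m (int (n * a), False) = elem m (0, False)"
      using pow_eq_id[OF assms(2), of n] unfolding one pow by (rule sym)
    also have "\<dots> \<longleftrightarrow> m dvd n * a"
      using \<open>0 < m\<close> by (simp only: elem_eq_iff fst_conv snd_conv diff_0_right int_dvd_int_iff simp_thms)
    finally show ?thesis .
  qed
  define g where "g = gcd a m"
  have g: "g \<noteq> 0" "gcd a m = g" using \<open>0 < m\<close> by (simp_all add: g_def)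
  obtain a' m' where a': "a = a' * g" and m': "m = m' * g" and cop: "coprime a' m'"
    using gcd_coprime_exists[of a m] g(1) unfolding g(2) by blast
  have "m dvd m' * a" by (subst m', subst a') simp
  then have "ord x dvd m'" using dvd[of m'] by simp
  moreover have "m' dvd ord x"
  proof -
    have "m dvd ord x * a" using dvd[of "ord x"] by simp
    then have "m' * g dvd ord x * a' * g" by (simp only: a' mult.assoc flip: m')
    then show ?thesis using cop g(1) by (simp add: coprime_commute coprime_dvd_mult_left_iff)
  qed
  ultimately have "ord x = m'" by (rule dvd_antisym)
  then have "m' * d = m' * g" using ord by (simp flip: m')
  moreover have "m' \<noteq> 0" using m' \<open>0 < m\<close> by (metis mult_0 less_not_refl)
  ultimately show "gcd (fst x) m = d" using g(2) by (simp add: a_def)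
qed

section \<open>From the integer path to a sequencing\<close>

lemma elem_scaled_eq_iff:
  assumes "0 < m" "coprime t m"
  shows "elem m (int t * fst g, snd g) = elem m (int t * fst h, snd h) \<longleftrightarrow>
    snd g = snd h \<and> int m dvd fst g - fst h"
proof -
  have "int m dvd int t * fst g - int t * fst h \<longleftrightarrow> int m dvd fst g - fst h"
    using assms(2) by (simp add: coprime_commute coprime_dvd_mult_right_iff flip: right_diff_distrib)
  then show ?thesis using assms(1) by (simp add: elem_eq_iff)
qed

lemma int_dvd_small_imp_zero:
  fixes z :: int
  assumes "int m dvd z" "\<bar>z\<bar> < int m"
  shows "z = 0"
  using assms zdvd_not_zless[of "\<bar>z\<bar>" "int m"] by auto

lemma has_S_sequencing_of_path:
  fixes k t D :: nat
  defines "m \<equiv> 2 * k + 1"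
  assumes cop: "coprime t m" and D: "0 < D" "D \<le> k"
    and len: "length hs = 4 * k + 1"
    and vertices: "({0..2 * int k} \<times> UNIV) - {(int k + 1, False)} \<subseteq> set hs"
    and quotients: "({- int k..int k} - {0, int D}) \<times> {False} \<union>
         ({0} \<union> {2 * int k} \<union> {2 * int k + 2..4 * int k}) \<times> {True} \<subseteq> set (quots hs)"
  shows "has_S_sequencing (dihedral m)
    (carrier (dihedral m) - {\<one>\<^bsub>dihedral m\<^esub>, elem m (int t * int D, False)})"
proof -
  have "0 < m" by (simp add: m_def)
  interpret group "dihedral m" by (rule group_dihedral[OF \<open>0 < m\<close>])
  \<comment> \<open>Scaling the coordinates by the unit t is injective modulo m and commutes with
    \<open>quot\<close>, since differences and sums are linear.\<close>
  define f where "f g = elem m (int t * fst g, snd g)" for g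
  have f_eq: "f g = f h \<longleftrightarrow> snd g = snd h \<and> int m dvd fst g - fst h" for g h
    unfolding f_def by (rule elem_scaled_eq_iff[OF \<open>0 < m\<close> cop])
  have f_carrier: "f g \<in> carrier (dihedral m)" for g
    using \<open>0 < m\<close> by (simp add: f_def del: dihedral_carrier)
  have f_quot: "inv\<^bsub>dihedral m\<^esub> f g \<otimes>\<^bsub>dihedral m\<^esub> f h = f (quot g h)" for g h
    unfolding f_def elem_inv_mult[OF \<open>0 < m\<close>] by (simp add: quot_def algebra_simps)

  let ?V = "({0..2 * int k} \<times> (UNIV :: bool set)) - {(int k + 1, False)}"
  have "inj_on f ?V"
  proof (rule inj_onI)
    fix g h assume gh: "g \<in> ?V" "h \<in> ?V" "f g = f h"
    then have "\<bar>fst g - fst h\<bar> < int m" by (auto simp: m_def abs_if)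
    then show "g = h" using gh(3)[unfolded f_eq] int_dvd_small_imp_zero[of m "fst g - fst h"]
      by (auto simp: prod_eq_iff)
  qed
  then have "card (f ` ?V) = card ?V" by (rule card_image)
  also have "\<dots> = 4 * k + 1"
    using D by (simp add: card_Diff_singleton card_cartesian_product)
  \<comment> \<open>The path has only as many entries as there are elements to cover, so none can
    repeat.\<close>
  finally have "4 * k + 1 \<le> card (set (map f hs))"
    using card_mono[of "set (map f hs)" "f ` ?V"] vertices by auto
  then have dist_hs: "distinct (map f hs)"
    using len by (intro card_distinct antisym card_length) simp

  let ?X = "({- int k..int k} - {0, int D}) \<times> {False}"
    and ?Y = "({0} \<union> {2 * int k} \<union> {2 * int k + 2..4 * int k}) \<times> {True}"
  \<comment> \<open>Two coordinates in \<open>?Y\<close> could differ by m, as they reach 4k. This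
    is prevented by the absence of 1, ..., 2k - 1, of 2k + 1 and of 4k + 1.\<close>
  have inj: "inj_on f (({- int k..int k} \<times> {False}) \<union> ?Y)"
  proof (rule inj_onI)
    fix g h assume gh: "g \<in> ({- int k..int k} \<times> {False}) \<union> ?Y"
      "h \<in> ({- int k..int k} \<times> {False}) \<union> ?Y" "f g = f h"
    have sd: "snd g = snd h" "int m dvd fst g - fst h" using gh(3) by (simp_all add: f_eq)
    then obtain q where q: "fst g - fst h = int m * q" by (auto elim: dvdE)
    have "\<bar>fst g - fst h\<bar> < 2 * int m" "fst g - fst h \<noteq> int m" "fst h - fst g \<noteq> int m"
      using gh(1,2) sd(1) by (auto simp: m_def)
    then have "int m * \<bar>q\<bar> < int m * 2" "q \<noteq> 1" "q \<noteq> - 1"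
      using q by (auto simp: abs_mult)
    then have "q = 0" using \<open>0 < m\<close> by (simp add: mult_less_cancel_left_pos)
    then show "g = h" using q sd(1) by (simp add: prod_eq_iff)
  qed
  have card_XY: "card (f ` (?X \<union> ?Y)) = 4 * k"
  proof -
    have "card (f ` (?X \<union> ?Y)) = card (?X \<union> ?Y)"
      by (intro card_image inj_on_subset[OF inj]) auto
    also have "\<dots> = card ?X + card ?Y" by (rule card_Un_disjoint) auto
    also have "card ?X = 2 * k - 1"
      using D by (simp add: card_cartesian_product card_Diff_subset)
    also have "card ?Y = 2 * k + 1"
      using D by (simp add: card_cartesian_product)
    finally show ?thesis using D by simp
  qed
  define gs where "gs = map f (quots hs)"
  have len_gs: "length gs = 4 * k" using len by (simp add: gs_def)
  have "f ` (?X \<union> ?Y) \<subseteq> set gs"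
    using quotients by (auto simp: gs_def)
  \<comment> \<open>The same count for quotients: 4k distinct values among 4k entries leave no other
    value and no repetition.\<close>
  then have set_gs: "f ` (?X \<union> ?Y) = set gs"
    using card_length[of gs] unfolding len_gs card_XY[symmetric] by (intro card_seteq finite_set)
  have dist_gs: "distinct gs"
    by (rule card_distinct) (simp only: card_XY len_gs flip: set_gs)

  let ?S = "carrier (dihedral m) - {\<one>\<^bsub>dihedral m\<^esub>, f (int D, False)}"
  have one: "\<one>\<^bsub>dihedral m\<^esub> = f (0, False)" by (simp add: f_def elem_def)
  have "set gs = ?S"
  proof (rule card_subset_eq)
    show "finite ?S" by simp
    show "set gs \<subseteq> ?S"
    proof
      fix y assume "y \<in> set gs"
      then obtain g where g: "g \<in> ?X \<union> ?Y" "y = f g" unfolding set_gs[symmetric] by blast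
      have "f g \<noteq> f (z, False)" if "z \<in> {0, int D}" for z
        using inj_onD[OF inj, of g "(z, False)"] g(1) that D by auto
      then show "y \<in> ?S" unfolding one g(2) using f_carrier by auto
    qed
    have "f (0, False) \<noteq> f (int D, False)"
      using inj_onD[OF inj, of "(0, False)" "(int D, False)"] D by auto
    then have "card ?S = card (carrier (dihedral m)) - 2"
      unfolding one using f_carrier by (subst card_Diff_subset) (auto simp del: dihedral_carrier)
    also have "\<dots> = 4 * k" by (simp add: card_cartesian_product m_def)
    finally show "card (set gs) = card ?S" unfolding set_gs[symmetric] card_XY by (rule sym)
  qed
  moreover obtain h hs' where hs: "hs = h # hs'" using len by (cases hs) auto
  have "gs = map2 (\<lambda>x y. inv\<^bsub>dihedral m\<^esub> x \<otimes>\<^bsub>dihedral m\<^esub> y) (f h # map f hs') (map f hs')"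
    unfolding gs_def hs
    by (rule nth_equalityI) (simp_all add: quots_nth f_quot nth_Cons' del: dihedral_mult_eq)
  then have "is_S_sequencing (dihedral m) (set gs) gs"
    using is_S_sequencing_quotients[of "f h" "map f hs'"] dist_hs dist_gs f_carrier
    by (simp add: hs image_subset_iff del: dihedral_carrier dihedral_mult_eq)
  ultimately show ?thesis unfolding has_S_sequencing_def f_def by auto
qed

section \<open>Choice of the parameters\<close>

theorem theorem5p10:
  fixes d :: nat
  assumes "0 < d"
  shows "finite {m :: nat. \<not> (m mod 8 \<in> {5, 7} \<longrightarrow>
           (\<forall>S x. S \<subseteq> carrier (dihedral m) - {\<one>\<^bsub>dihedral m\<^esub>}
               \<and> card S = 2 * m - 2
               \<and> x \<in> carrier (dihedral m) - {\<one>\<^bsub>dihedral m\<^esub>} - S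
               \<and> group.ord (dihedral m) x * d = m
             \<longrightarrow> has_S_sequencing (dihedral m) S))}"
proof (rule finite_subset)
  \<comment> \<open>For m > N, k exceeds 8 (2d + 1)^2 + 9. With D at most 2d and 2c = k + 1 - D,
    this yields both 3 \<le> c and 4 (D + 1)^2 \<le> c + D.\<close>
  define N where "N = 16 * (2 * d + 1) ^ 2 + 20"
  show "finite {..N}" by simp
  have main: "has_S_sequencing (dihedral m) S"
    if "N < m" "m mod 8 \<in> {5, 7}" "S \<subseteq> carrier (dihedral m) - {\<one>\<^bsub>dihedral m\<^esub>}"
      "card S = 2 * m - 2" "x \<in> carrier (dihedral m) - {\<one>\<^bsub>dihedral m\<^esub>} - S"
      and ord: "group.ord (dihedral m) x * d = m" for m S x
  proof -
    have "odd m" using that(2) by auto presburger+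
    then obtain k where m: "m = 2 * k + 1" by (elim oddE)
    have x: "x = (fst x, False)" "gcd (fst x) m = d"
      using dihedral_ord[OF \<open>odd m\<close> _ _ ord] that(5) by auto
    then have "d dvd m" by (metis gcd_dvd2)
    then have "odd d" using \<open>odd m\<close> by (metis dvd_trans)
    \<comment> \<open>As d is odd, D has the parity of k + 1, so c is exactly half of k + 1 - D. As
      m is odd, doubling d does not change the gcd with m.\<close>
    define D where "D = (if even k then d else 2 * d)"
    have "0 < D" "D \<le> 2 * d" using assms by (simp_all add: D_def)
    moreover have "even (k + 1 - D)" using \<open>odd d\<close> by (auto simp: D_def)
    moreover have "gcd D m = d"
    proof -
      have "coprime 2 m" using \<open>odd m\<close> by simp
      then have "gcd D m = gcd d m" by (simp add: D_def gcd_mult_left_left_cancel)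
      then show ?thesis using \<open>d dvd m\<close> by (simp add: gcd_nat.absorb1)
    qed
    ultimately have D: "0 < D" "D \<le> 2 * d" "even (k + 1 - D)" "gcd D m = d" by auto
    define c where "c = (k + 1 - D) div 2"
    have "(D + 1) ^ 2 \<le> (2 * d + 1) ^ 2" using D(2) by (intro power_mono) auto
    moreover have "2 * d + 1 \<le> (2 * d + 1) ^ 2" by (rule self_le_power) auto
    moreover have "8 * (2 * d + 1) ^ 2 + 9 < k" using that(1) unfolding m N_def by linarith
    moreover have "2 * c = k + 1 - D" unfolding c_def using D(3) by simp
    ultimately have c: "k + 1 = 2 * c + D" "3 \<le> c" "4 * (D + 1) ^ 2 \<le> c + D" "D \<le> k"
      using D(2) by linarith+
    obtain hs where hs: "length hs = 4 * k + 1"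
      "({0..2 * int k} \<times> UNIV) - {(int k + 1, False)} \<subseteq> set hs"
      "({- int k..int k} - {0, int D}) \<times> {False} \<union>
         ({0} \<union> {2 * int k} \<union> {2 * int k + 2..4 * int k}) \<times> {True} \<subseteq> set (quots hs)"
      using near_hamiltonian_path[OF c(1,2) D(1) c(3)] by metis
    obtain t where t: "coprime t m" "[t * D = fst x] (mod m)"
      using exists_unit_cong[of m D "fst x"] x(2) D(4) m by auto
    have "fst x < m" using that(5) by auto
    then have "(t * D) mod m = fst x" using t(2) by (simp add: cong_def)
    then have "elem m (int t * int D, False) = (fst x, False)"
      by (simp add: elem_def flip: of_nat_mult of_nat_mod)
    then have seq: "has_S_sequencing (dihedral m) (carrier (dihedral m) - {\<one>\<^bsub>dihedral m\<^esub>, x})"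
      using has_S_sequencing_of_path[OF _ D(1) c(4) hs, of t] t(1) x(1) unfolding m by simp
    \<comment> \<open>S avoids the identity and x, and its 2m - 2 elements exhaust what
      remains.\<close>
    have "S = carrier (dihedral m) - {\<one>\<^bsub>dihedral m\<^esub>, x}"
    proof (rule card_subset_eq)
      show "finite (carrier (dihedral m) - {\<one>\<^bsub>dihedral m\<^esub>, x})" by simp
      show "S \<subseteq> carrier (dihedral m) - {\<one>\<^bsub>dihedral m\<^esub>, x}" using that(3,5) by blast
      have "\<one>\<^bsub>dihedral m\<^esub> \<in> carrier (dihedral m)" using m by simp
      then have "card (carrier (dihedral m) - {\<one>\<^bsub>dihedral m\<^esub>, x}) = card (carrier (dihedral m)) - 2"
        using that(5) by (subst card_Diff_subset) (auto simp del: dihedral_carrier dihedral_one)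
      then show "card S = card (carrier (dihedral m) - {\<one>\<^bsub>dihedral m\<^esub>, x})"
        using that(4) by (simp add: card_cartesian_product)
    qed
    then show ?thesis using seq by simp
  qed
  show "{m :: nat. \<not> (m mod 8 \<in> {5, 7} \<longrightarrow>
           (\<forall>S x. S \<subseteq> carrier (dihedral m) - {\<one>\<^bsub>dihedral m\<^esub>}
               \<and> card S = 2 * m - 2
               \<and> x \<in> carrier (dihedral m) - {\<one>\<^bsub>dihedral m\<^esub>} - S
               \<and> group.ord (dihedral m) x * d = m
             \<longrightarrow> has_S_sequencing (dihedral m) S))} \<subseteq> {..N}"
    (is "?A \<subseteq> _")
  proof
    fix m assume "m \<in> ?A"
    then obtain S x where "m mod 8 \<in> {5, 7}" "S \<subseteq> carrier (dihedral m) - {\<one>\<^bsub>dihedral m\<^esub>}"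
      "card S = 2 * m - 2" "x \<in> carrier (dihedral m) - {\<one>\<^bsub>dihedral m\<^esub>} - S"
      "group.ord (dihedral m) x * d = m" "\<not> has_S_sequencing (dihedral m) S"
      by blast
    then have "\<not> N < m" using main[of m S x] by blast
    then show "m \<in> {..N}" by simp
  qed
qed

end
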